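(* Let $d,s$ be positive integers. If $X\subseteq\mathrm{U}(d)$ is a unitary $s$-distance set, then \[ |X| \leq \dim \mathrm{Hom}_{\mathrm{U}(d)}(s,s). \] Moreover, if there exist $U, M\in X$ that are orthogonal (i.e. $\operatorname{tr}(U^*M)=0$), then \[ |X| \leq \dim \mathrm{Hom}_{\mathrm{U}(d)}(s,s-1). \]
   Context: $\mathrm{U}(d)$ is the group of $d\times d$ complex unitary matrices. A finite subset $X\subseteq\mathrm{U}(d)$ is a unitary $s$-distance set (unitary code of degree $s$) if the quantity $|\operatorname{tr}(U^*M)|^2$ takes only $s$ distinct values as $(U,M)$ ranges over pairs of distinct elements of $X$. For nonnegative integers $r,s$, $\mathrm{Hom}_{\mathrm{U}(d)}(r,s)$ denotes the complex vector space of functions on $\mathrm{U}(d)$ given by polynomials that are homogeneous of degree $r$ in the matrix entries of $U$ and homogeneous of degree $s$ in the matrix entries of $U^*$.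
   Formalization: The formal theorem additionally assumes that no two distinct elements of X are equal up to a global phase; without this the claim fails, e.g. d = s = 1, X = {1, −1} has |X| = 2 but dim Hom(1,1) = 1. *)

theory Defs
  imports "HOL-Analysis.Analysis" "HOL-Library.Function_Algebras"
begin

definition conj_transpose :: "complex^'n^'m \<Rightarrow> complex^'m^'n" where
  "conj_transpose A = (\<chi> i j. cnj (A $ j $ i))"

definition unitary_group :: "(complex^'d^'d) set" where
  "unitary_group = {U. conj_transpose U ** U = mat 1 \<and> U ** conj_transpose U = mat 1}"

definition trace_inner :: "complex^'d^'d \<Rightarrow> complex^'d^'d \<Rightarrow> complex" where
  "trace_inner U M = trace (conj_transpose U ** M)"

definition unitary_distance_set :: "nat \<Rightarrow> (complex^'d^'d) set \<Rightarrow> bool" where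
  "unitary_distance_set s X \<longleftrightarrow>
     finite X \<and> X \<subseteq> unitary_group \<and>
     card {(cmod (trace_inner U M))\<^sup>2 |U M. U \<in> X \<and> M \<in> X \<and> U \<noteq> M} = s"

(* The quantity |tr(U* M)|^2 does not see global phases, so matrices in a unitary
   code are regarded up to a phase. Without this, a set such as {1, -1} in U(1) would
   be a 1-distance set (with value d^2 = 1) exceeding dim Hom(1,1) = 1. *)
definition equal_up_to_phase :: "complex^'d^'d \<Rightarrow> complex^'d^'d \<Rightarrow> bool" where
  "equal_up_to_phase U M \<longleftrightarrow> (\<exists>c. cmod c = 1 \<and> (\<forall>i j. U $ i $ j = c * M $ i $ j))"

definition fun_scale :: "complex \<Rightarrow> ('a \<Rightarrow> complex) \<Rightarrow> 'a \<Rightarrow> complex" where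
  "fun_scale c f = (\<lambda>x. c * f x)"

global_interpretation cfun: vector_space "fun_scale :: complex \<Rightarrow> ('a \<Rightarrow> complex) \<Rightarrow> 'a \<Rightarrow> complex"
  by unfold_locales (auto simp: fun_scale_def algebra_simps)

(* Exponents of the matrix entries in a monomial of total degree r. *)
definition exponents :: "nat \<Rightarrow> ('d::finite \<Rightarrow> 'd \<Rightarrow> nat) set" where
  "exponents r = {a. (\<Sum>i\<in>UNIV. \<Sum>j\<in>UNIV. a i j) = r}"

definition entry_monomial :: "('d \<Rightarrow> 'd \<Rightarrow> nat) \<Rightarrow> complex^'d^'d \<Rightarrow> complex" where
  "entry_monomial a U = (\<Prod>i\<in>UNIV. \<Prod>j\<in>UNIV. (U $ i $ j) ^ a i j)"

(* Elements are functions on the unitary group only: they are made total by the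
   value 0 outside it, so that two polynomials agreeing on the unitary group
   give the same element. *)
definition Hom :: "nat \<Rightarrow> nat \<Rightarrow> (complex^'d^'d \<Rightarrow> complex) set" where
  "Hom r s = {f. \<exists>c. f = (\<lambda>U. if U \<in> unitary_group
       then \<Sum>a\<in>exponents r. \<Sum>b\<in>exponents s.
              c a b * entry_monomial a U * entry_monomial b (conj_transpose U)
       else 0)}"

lemma finite_exponents: "finite (exponents r :: ('d::finite \<Rightarrow> 'd \<Rightarrow> nat) set)"
proof -
  have "a i j \<le> r" if "a \<in> exponents r" for a :: "'d \<Rightarrow> 'd \<Rightarrow> nat" and i j
  proof -
    have "a i j \<le> (\<Sum>j\<in>UNIV. a i j)" by (rule member_le_sum) auto
    also have "\<dots> \<le> (\<Sum>i\<in>UNIV. \<Sum>j\<in>UNIV. a i j)"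
      by (rule member_le_sum[where f = "\<lambda>i. \<Sum>j\<in>UNIV. a i j"]) auto
    finally show ?thesis using that by (simp add: exponents_def)
  qed
  then have "(exponents r :: ('d \<Rightarrow> 'd \<Rightarrow> nat) set) \<subseteq>
      (UNIV :: 'd set) \<rightarrow>\<^sub>E ((UNIV :: 'd set) \<rightarrow>\<^sub>E {..r})"
    by (auto simp: PiE_def extensional_def)
  moreover have "finite ((UNIV :: 'd set) \<rightarrow>\<^sub>E ((UNIV :: 'd set) \<rightarrow>\<^sub>E {..r}))"
    by (intro finite_PiE) auto
  ultimately show ?thesis by (rule finite_subset)
qed

lemma subspace_Hom: "cfun.subspace (Hom r s :: (complex^'d^'d \<Rightarrow> complex) set)"
proof (rule cfun.subspaceI)
  show "0 \<in> (Hom r s :: (complex^'d^'d \<Rightarrow> complex) set)"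
    unfolding Hom_def by (auto intro!: exI[of _ "\<lambda>_ _. 0"])
next
  fix f g :: "complex^'d^'d \<Rightarrow> complex" assume "f \<in> Hom r s" "g \<in> Hom r s"
  then obtain c e where
    "f = (\<lambda>U. if U \<in> unitary_group then \<Sum>a\<in>exponents r. \<Sum>b\<in>exponents s.
              c a b * entry_monomial a U * entry_monomial b (conj_transpose U) else 0)"
    "g = (\<lambda>U. if U \<in> unitary_group then \<Sum>a\<in>exponents r. \<Sum>b\<in>exponents s.
              e a b * entry_monomial a U * entry_monomial b (conj_transpose U) else 0)"
    unfolding Hom_def by blast
  then show "f + g \<in> Hom r s"
    unfolding Hom_def
    by (auto intro!: exI[of _ "\<lambda>a b. c a b + e a b"] simp: sum.distrib distrib_right fun_eq_iff)
next
  fix k and f :: "complex^'d^'d \<Rightarrow> complex" assume "f \<in> Hom r s"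
  then obtain c where
    "f = (\<lambda>U. if U \<in> unitary_group then \<Sum>a\<in>exponents r. \<Sum>b\<in>exponents s.
              c a b * entry_monomial a U * entry_monomial b (conj_transpose U) else 0)"
    unfolding Hom_def by blast
  then show "fun_scale k f \<in> Hom r s"
    unfolding Hom_def fun_scale_def
    by (auto intro!: exI[of _ "\<lambda>a b. k * c a b"] simp: sum_distrib_left mult.assoc fun_eq_iff)
qed

end

theory Submission
  imports Defs
begin

text \<open>
  With \<open>D\<close> the set of values \<open>|tr (U\<^sup>* M)|\<^sup>2\<close> of the code, attach to each \<open>U \<in> X\<close> the function
  \<open>M \<mapsto> \<Prod>\<alpha>\<in>D. |tr (U\<^sup>* M)|\<^sup>2 - \<alpha>\<close>. It vanishes on \<open>X - {U}\<close> but not at \<open>U\<close>, because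
  \<open>|tr (U\<^sup>* M)| = d\<close> forces equality up to a phase; so these functions are linearly independent.
  Writing \<open>\<alpha> = (\<alpha> / d) tr (M\<^sup>* M)\<close> makes every factor homogeneous of degree \<open>(1, 1)\<close>.
  If \<open>0 \<in> D\<close>, the factor for \<open>\<alpha> = 0\<close> can be replaced by \<open>tr (U\<^sup>* M)\<close>, of degree \<open>(1, 0)\<close>.
\<close>

subsection \<open>Linear independence from point evaluations\<close>

text \<open>\<open>dim\<close> is the \<open>card\<close> of a basis, hence 0 if the basis is
  infinite. The finite spanning set \<open>G\<close> rules this out: every independent subset of
  \<open>V\<close> is finite, so extending \<open>S\<close> to a basis \<open>B\<close> of
  \<open>V\<close> can only raise the cardinality.\<close>

lemma (in vector_space) card_le_dim_of_independent:
  assumes "finite G" "V \<subseteq> span G" "S \<subseteq> V" "independent S"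
  shows "card S \<le> dim V"
proof -
  obtain B where B: "S \<subseteq> B" "B \<subseteq> V" "independent B" "V \<subseteq> span B"
    using maximal_independent_subset_extend[OF assms(3,4)] by blast
  have "finite B"
    using independent_span_bound[OF assms(1) B(3)] B(2) assms(2) by blast
  then have "card S \<le> card B"
    using B(1) by (rule card_mono)
  also have "card B = dim V"
    using B by (intro basis_card_eq_dim)
  finally show ?thesis .
qed

lemma fun_sum_apply: "(\<Sum>i\<in>A. f i) x = (\<Sum>i\<in>A. f i x)"
  for f :: "'i \<Rightarrow> 'a \<Rightarrow> 'b::comm_monoid_add"
  by (induction A rule: infinite_finite_induct) auto

text \<open>The matrix of values \<open>f x y\<close> is diagonal with nonzero diagonal. Evaluating
  a vanishing linear combination at \<open>x\<close> therefore isolates the coefficient of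
  \<open>f x\<close> and forces it to be 0.\<close>

lemma card_le_dim_of_diagonal:
  fixes f :: "'a \<Rightarrow> 'a \<Rightarrow> complex"
  assumes X: "finite X" and G: "finite G" "V \<subseteq> cfun.span G"
    and V: "\<And>x. x \<in> X \<Longrightarrow> f x \<in> V"
    and diag: "\<And>x. x \<in> X \<Longrightarrow> f x x \<noteq> 0"
    and off_diag: "\<And>x y. x \<in> X \<Longrightarrow> y \<in> X \<Longrightarrow> x \<noteq> y \<Longrightarrow> f x y = 0"
  shows "card X \<le> cfun.dim V"
proof -
  \<comment> \<open>If \<open>f x = f y\<close> with \<open>x\<close> and \<open>y\<close> distinct,
    then \<open>f x x = f y x = 0\<close>, against \<open>diag\<close>.\<close>
  have inj: "inj_on f X"
    by (rule inj_onI) (metis diag off_diag)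
  have "cfun.independent (f ` X)"
  proof (rule cfun.independent_if_scalars_zero)
    show "finite (f ` X)" using X by simp
    fix c g assume 0: "(\<Sum>h\<in>f ` X. fun_scale (c h) h) = 0" and "g \<in> f ` X"
    then obtain x where x: "x \<in> X" "g = f x" by blast
    have "0 = (\<Sum>h\<in>f ` X. fun_scale (c h) h) x"
      using 0 by simp
    also have "\<dots> = (\<Sum>y\<in>X. c (f y) * f y x)"
      by (simp add: fun_sum_apply sum.reindex[OF inj] fun_scale_def)
    also have "\<dots> = (\<Sum>y\<in>X. if y = x then c (f x) * f x x else 0)"
      using x(1) off_diag by (intro sum.cong) auto
    also have "\<dots> = c (f x) * f x x"
      using X x(1) by simp
    finally show "c g = 0" using x diag by simp
  qed
  then have "card (f ` X) \<le> cfun.dim V"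
    using G V by (intro cfun.card_le_dim_of_independent) auto
  then show ?thesis using card_image[OF inj] by simp
qed

subsection \<open>Homogeneous polynomial functions\<close>

text \<open>The same extension by 0 as in \<open>Hom\<close>, so that membership can be proved for a
  polynomial expression \<open>p\<close> whatever its values outside the unitary group.\<close>

definition on_unitary :: "(complex^'d^'d \<Rightarrow> complex) \<Rightarrow> complex^'d^'d \<Rightarrow> complex" where
  "on_unitary p = (\<lambda>U. if U \<in> unitary_group then p U else 0)"

lemma Hom_sum:
  assumes "\<And>i. i \<in> I \<Longrightarrow> on_unitary (p i) \<in> Hom r s"
  shows "on_unitary (\<lambda>U. \<Sum>i\<in>I. p i U) \<in> Hom r s"
proof -
  have "on_unitary (\<lambda>U. \<Sum>i\<in>I. p i U) = (\<Sum>i\<in>I. on_unitary (p i))"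
    by (auto simp: on_unitary_def fun_sum_apply)
  then show ?thesis
    using cfun.subspace_sum[OF subspace_Hom assms] by simp
qed

lemma Hom_cmult:
  assumes "on_unitary p \<in> Hom r s"
  shows "on_unitary (\<lambda>U. c * p U) \<in> Hom r s"
proof -
  have "on_unitary (\<lambda>U. c * p U) = fun_scale c (on_unitary p)"
    by (auto simp: on_unitary_def fun_scale_def)
  then show ?thesis
    using cfun.subspace_scale[OF subspace_Hom assms] by simp
qed

lemma Hom_diff:
  assumes "on_unitary p \<in> Hom r s" "on_unitary q \<in> Hom r s"
  shows "on_unitary (\<lambda>U. p U - q U) \<in> Hom r s"
proof -
  have "on_unitary (\<lambda>U. p U - q U) = on_unitary p - on_unitary q"
    by (auto simp: on_unitary_def)
  then show ?thesis
    using cfun.subspace_diff[OF subspace_Hom assms] by simp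
qed

text \<open>The coefficient family is the indicator of the pair \<open>(a, b)\<close>.\<close>

lemma Hom_monomial:
  assumes "a \<in> exponents r" "b \<in> exponents s"
  shows "on_unitary (\<lambda>U. entry_monomial a U * entry_monomial b (conj_transpose U)) \<in> Hom r s"
proof -
  have "(\<Sum>a'\<in>exponents r. \<Sum>b'\<in>exponents s.
          (if a' = a \<and> b' = b then 1 else 0) *
          entry_monomial a' U * entry_monomial b' (conj_transpose U)) =
        entry_monomial a U * entry_monomial b (conj_transpose U)" for U :: "complex^'a^'a"
  proof -
    have "(\<Sum>a'\<in>exponents r. \<Sum>b'\<in>exponents s.
            (if a' = a \<and> b' = b then 1 else 0) *
            entry_monomial a' U * entry_monomial b' (conj_transpose U)) =
          (\<Sum>a'\<in>exponents r. if a' = a then \<Sum>b'\<in>exponents s. if b' = b then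
            entry_monomial a U * entry_monomial b (conj_transpose U) else 0 else 0)"
      by (intro sum.cong) (auto intro!: sum.cong)
    then show ?thesis using assms by (simp add: finite_exponents)
  qed
  then show ?thesis
    unfolding Hom_def on_unitary_def
    by (auto intro!: exI[of _ "\<lambda>a' b'. if a' = a \<and> b' = b then 1 else 0"])
qed

lemma Hom_eq_monomial_sum:
  assumes "on_unitary p \<in> Hom r s"
  obtains c where "\<And>U. U \<in> unitary_group \<Longrightarrow>
    p U = (\<Sum>a\<in>exponents r. \<Sum>b\<in>exponents s.
      c a b * (entry_monomial a U * entry_monomial b (conj_transpose U)))"
proof -
  obtain c where c: "on_unitary p = (\<lambda>U. if U \<in> unitary_group
       then \<Sum>a\<in>exponents r. \<Sum>b\<in>exponents s.
              c a b * entry_monomial a U * entry_monomial b (conj_transpose U)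
       else 0)"
    using assms unfolding Hom_def by blast
  show ?thesis
  proof
    fix U :: "complex^'a^'a" assume "U \<in> unitary_group"
    then show "p U = (\<Sum>a\<in>exponents r. \<Sum>b\<in>exponents s.
      c a b * (entry_monomial a U * entry_monomial b (conj_transpose U)))"
      using fun_cong[OF c, of U] by (simp add: on_unitary_def mult.assoc)
  qed
qed

lemma on_unitary_cong:
  "(\<And>U. U \<in> unitary_group \<Longrightarrow> p U = q U) \<Longrightarrow> on_unitary p = on_unitary q"
  by (auto simp: on_unitary_def)

lemma entry_monomial_mult:
  "entry_monomial a U * entry_monomial b U = entry_monomial (\<lambda>i j. a i j + b i j) U"
  by (simp add: entry_monomial_def power_add prod.distrib)

lemma exponents_add:
  "a \<in> exponents r \<Longrightarrow> b \<in> exponents s \<Longrightarrow> (\<lambda>i j. a i j + b i j) \<in> exponents (r + s)"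
  by (simp add: exponents_def sum.distrib)

text \<open>Multiply out the two monomial sums: exponents add in a product of monomials, so
  bidegrees add as well.\<close>

lemma Hom_mult:
  assumes "on_unitary p \<in> Hom r s" "on_unitary q \<in> Hom r' s'"
  shows "on_unitary (\<lambda>U. p U * q U) \<in> Hom (r + r') (s + s')"
proof -
  define m where "m a b U = entry_monomial a U * entry_monomial b (conj_transpose U)"
    for a b and U :: "complex^'a^'a"
  obtain c where c: "\<And>U. U \<in> unitary_group \<Longrightarrow>
      p U = (\<Sum>a\<in>exponents r. \<Sum>b\<in>exponents s. c a b * m a b U)"
    using Hom_eq_monomial_sum[OF assms(1)] unfolding m_def by blast
  obtain e where e: "\<And>U. U \<in> unitary_group \<Longrightarrow>
      q U = (\<Sum>a\<in>exponents r'. \<Sum>b\<in>exponents s'. e a b * m a b U)"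
    using Hom_eq_monomial_sum[OF assms(2)] unfolding m_def by blast
  have m: "m a b U * m a' b' U = m (\<lambda>i j. a i j + a' i j) (\<lambda>i j. b i j + b' i j) U"
    for a b a' b' U
    by (simp add: m_def entry_monomial_mult[symmetric])
  have "on_unitary (\<lambda>U. p U * q U) = on_unitary (\<lambda>U.
      \<Sum>a\<in>exponents r. \<Sum>b\<in>exponents s. \<Sum>a'\<in>exponents r'. \<Sum>b'\<in>exponents s'.
        c a b * e a' b' * m (\<lambda>i j. a i j + a' i j) (\<lambda>i j. b i j + b' i j) U)"
  proof (rule on_unitary_cong)
    fix U :: "complex^'a^'a" assume U: "U \<in> unitary_group"
    have "p U * q U = (\<Sum>a\<in>exponents r. \<Sum>b\<in>exponents s. c a b * m a b U * q U)"
      by (simp only: c[OF U] sum_distrib_right)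
    also have "\<dots> = (\<Sum>a\<in>exponents r. \<Sum>b\<in>exponents s. \<Sum>a'\<in>exponents r'. \<Sum>b'\<in>exponents s'.
        c a b * m a b U * (e a' b' * m a' b' U))"
      by (simp only: e[OF U] sum_distrib_left)
    finally show "p U * q U = (\<Sum>a\<in>exponents r. \<Sum>b\<in>exponents s.
        \<Sum>a'\<in>exponents r'. \<Sum>b'\<in>exponents s'.
        c a b * e a' b' * m (\<lambda>i j. a i j + a' i j) (\<lambda>i j. b i j + b' i j) U)"
      by (simp add: m[symmetric] mult_ac)
  qed
  also have "\<dots> \<in> Hom (r + r') (s + s')"
    unfolding m_def
    by (intro Hom_sum Hom_cmult Hom_monomial exponents_add)
  finally show ?thesis .
qed

lemma zero_in_exponents: "(\<lambda>_ _. 0) \<in> exponents 0"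
  by (simp add: exponents_def)

lemma Hom_one: "on_unitary (\<lambda>_. 1) \<in> Hom 0 0"
  using Hom_monomial[OF zero_in_exponents zero_in_exponents]
  by (simp add: entry_monomial_def)

lemma Hom_prod:
  assumes "finite I" "\<And>i. i \<in> I \<Longrightarrow> on_unitary (p i) \<in> Hom r s"
  shows "on_unitary (\<lambda>U. \<Prod>i\<in>I. p i U) \<in> Hom (card I * r) (card I * s)"
  using assms
proof (induction I rule: finite_induct)
  case empty
  then show ?case by (simp add: Hom_one)
next
  case (insert i I)
  then show ?case
    using Hom_mult[of "p i" r s "\<lambda>U. \<Prod>i\<in>I. p i U"] by simp
qed

lemma single_entry_exponents:
  "(\<lambda>k l. if k = i \<and> l = j then 1 else 0) \<in> exponents 1"
proof -
  have "(\<Sum>k\<in>UNIV. \<Sum>l\<in>UNIV. if k = i \<and> l = j then 1 else 0 :: nat) =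
        (\<Sum>k\<in>UNIV. if k = i then \<Sum>l\<in>UNIV. if l = j then 1 else 0 else 0)"
    by (intro sum.cong) (auto intro!: sum.cong)
  then show ?thesis by (simp add: exponents_def)
qed

lemma entry_monomial_single:
  "entry_monomial (\<lambda>k l. if k = i \<and> l = j then 1 else 0) U = U $ i $ j"
proof -
  have "entry_monomial (\<lambda>k l. if k = i \<and> l = j then 1 else 0) U =
        (\<Prod>k\<in>UNIV. if k = i then \<Prod>l\<in>UNIV. if l = j then U $ i $ j else 1 else 1)"
    unfolding entry_monomial_def
  proof (intro prod.cong refl)
    fix k
    show "(\<Prod>l\<in>UNIV. (U $ k $ l) ^ (if k = i \<and> l = j then 1 else 0)) =
        (if k = i then \<Prod>l\<in>UNIV. if l = j then U $ i $ j else 1 else 1)"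
      \<comment> \<open>Without the delta rules the right-hand product stays unevaluated, and
        \<open>prod.cong\<close> can compare the two sides factor by factor.\<close>
      by (cases "k = i") (auto simp del: prod.delta prod.delta' intro!: prod.cong)
  qed
  then show ?thesis by simp
qed

lemma Hom_entry: "on_unitary (\<lambda>U. U $ i $ j) \<in> Hom 1 0"
  using Hom_monomial[OF single_entry_exponents zero_in_exponents]
  unfolding entry_monomial_single by (simp add: entry_monomial_def)

lemma Hom_cnj_entry: "on_unitary (\<lambda>U. cnj (U $ i $ j)) \<in> Hom 0 1"
  \<comment> \<open>The indices are swapped because the conjugate of entry \<open>(i, j)\<close> is
    entry \<open>(j, i)\<close> of the conjugate transpose.\<close>
  using Hom_monomial[OF zero_in_exponents single_entry_exponents[of j i]]
  unfolding entry_monomial_single by (simp add: entry_monomial_def conj_transpose_def)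

text \<open>The finitely many monomials of bidegree \<open>(r, s)\<close> span; this supplies the
  finite \<open>G\<close> required for the dimension bound.\<close>

lemma Hom_finitely_spanned:
  obtains G where "finite G" "Hom r s \<subseteq> cfun.span G"
proof
  define m where "m a b = on_unitary (\<lambda>U :: complex^'a^'a.
    entry_monomial a U * entry_monomial b (conj_transpose U))" for a b
  define G where "G = (\<lambda>(a, b). m a b) ` (exponents r \<times> exponents s)"
  show "finite G"
    by (simp add: G_def finite_exponents)
  show "Hom r s \<subseteq> cfun.span G"
  proof
    fix f :: "complex^'a^'a \<Rightarrow> complex" assume "f \<in> Hom r s"
    then obtain c where "f = (\<lambda>U. if U \<in> unitary_group
       then \<Sum>a\<in>exponents r. \<Sum>b\<in>exponents s.
              c a b * entry_monomial a U * entry_monomial b (conj_transpose U)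
       else 0)"
      unfolding Hom_def by blast
    then have "f = (\<Sum>a\<in>exponents r. \<Sum>b\<in>exponents s. fun_scale (c a b) (m a b))"
      by (auto simp: fun_eq_iff fun_sum_apply fun_scale_def m_def on_unitary_def mult.assoc)
    also have "\<dots> \<in> cfun.span G"
      unfolding G_def
      by (intro cfun.span_sum cfun.span_scale cfun.span_base) auto
    finally show "f \<in> cfun.span G" .
  qed
qed

subsection \<open>The trace inner product\<close>

lemma trace_inner_eq_sum:
  "trace_inner U M = (\<Sum>i\<in>UNIV. \<Sum>j\<in>UNIV. cnj (U $ j $ i) * M $ j $ i)"
  by (simp add: trace_inner_def trace_def matrix_matrix_mult_def conj_transpose_def)

lemma trace_inner_self:
  assumes "U \<in> unitary_group"
  shows "trace_inner (U :: complex^'d^'d) U = of_nat CARD('d)"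
  using assms by (simp add: trace_inner_def unitary_group_def trace_def mat_def)

lemma Hom_trace_inner: "on_unitary (\<lambda>M. trace_inner U M) \<in> Hom 1 0"
  unfolding trace_inner_eq_sum by (intro Hom_sum Hom_cmult Hom_entry)

lemma Hom_cnj_trace_inner: "on_unitary (\<lambda>M. cnj (trace_inner U M)) \<in> Hom 0 1"
  unfolding trace_inner_eq_sum cnj_sum complex_cnj_mult
  by (intro Hom_sum Hom_cmult Hom_cnj_entry)

text \<open>As a function this is the constant d, but written as a polynomial it has bidegree (1,
  1), so it can homogenize constants.\<close>

lemma Hom_trace_inner_self: "on_unitary (\<lambda>M. trace_inner M M) \<in> Hom 1 1"
  unfolding trace_inner_eq_sum
  using Hom_mult[OF Hom_cnj_entry Hom_entry] by (intro Hom_sum) simp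

lemma Hom_cmod_trace_inner_diff:
  "on_unitary (\<lambda>M. of_real ((cmod (trace_inner U M))\<^sup>2 - \<alpha>)) \<in> Hom 1 1"
proof -
  have "on_unitary (\<lambda>M. of_real ((cmod (trace_inner U M))\<^sup>2 - \<alpha>)) =
      on_unitary (\<lambda>M. trace_inner U M * cnj (trace_inner U M) -
        of_real \<alpha> / of_nat CARD('a) * trace_inner M M)"
    by (rule on_unitary_cong)
      (simp add: trace_inner_self complex_norm_square del: of_real_power flip: of_real_power)
  also have "\<dots> \<in> Hom 1 1"
    using Hom_mult[OF Hom_trace_inner Hom_cnj_trace_inner]
    by (intro Hom_diff Hom_cmult Hom_trace_inner_self) simp
  finally show ?thesis .
qed

text \<open>The equality case of Cauchy--Schwarz: \<open>M - c U\<close> has norm zero for \<open>c = tr (U\<^sup>* M) / d\<close>.\<close>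

lemma equal_up_to_phase_if_cmod_trace_inner:
  fixes U M :: "complex^'d^'d"
  assumes U: "U \<in> unitary_group" and M: "M \<in> unitary_group"
    and eq: "cmod (trace_inner U M) = CARD('d)"
  shows "equal_up_to_phase M U"
proof -
  define t where "t = trace_inner U M"
  define d where "d = (of_nat CARD('d) :: complex)"
  define c where "c = t / d"
  have d: "d \<noteq> 0" "cnj d = d" by (simp_all add: d_def)
  have tt: "t * cnj t = d * d"
    using eq by (simp add: t_def d_def flip: complex_norm_square power2_eq_square)
  have "complex_of_real (\<Sum>i\<in>UNIV. \<Sum>j\<in>UNIV. (cmod (M $ j $ i - c * U $ j $ i))\<^sup>2) =
      (\<Sum>i\<in>UNIV. \<Sum>j\<in>UNIV. (M $ j $ i - c * U $ j $ i) * cnj (M $ j $ i - c * U $ j $ i))"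
    by (simp add: complex_norm_square del: of_real_power flip: of_real_power)
  also have "\<dots> = trace_inner M M - c * cnj (trace_inner U M) - cnj c * trace_inner U M
      + c * cnj c * trace_inner U U"
    by (simp add: trace_inner_eq_sum sum_distrib_left sum.distrib[symmetric]
        sum_subtractf[symmetric] algebra_simps)
  \<comment> \<open>With \<open>c = t / d\<close> and \<open>t * cnj t = d * d\<close>, the four
    terms are d, -d, -d and d.\<close>
  also have "\<dots> = 0"
    using tt d by (simp add: trace_inner_self[OF U] trace_inner_self[OF M] c_def field_simps
        flip: t_def d_def)
  finally have "(\<Sum>i\<in>UNIV. \<Sum>j\<in>UNIV. (cmod (M $ j $ i - c * U $ j $ i))\<^sup>2) = 0"
    by (simp only: of_real_eq_0_iff)
  then have "M $ j $ i = c * U $ j $ i" for i j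
    by (simp add: sum_nonneg_eq_0_iff sum_nonneg)
  moreover have "cmod c = 1"
    using eq by (simp add: c_def d_def t_def norm_divide)
  ultimately show ?thesis
    unfolding equal_up_to_phase_def by blast
qed

section \<open>The annihilating polynomials of a code and the two bounds\<close>

theorem theorem3p2:
  fixes X :: "(complex^'d^'d) set" and s :: nat
  assumes "s > 0"
    and "unitary_distance_set s X"
    and distinct_mod_phase: "\<And>U M. U \<in> X \<Longrightarrow> M \<in> X \<Longrightarrow> equal_up_to_phase U M \<Longrightarrow> U = M"
  shows "card X \<le> cfun.dim (Hom s s :: (complex^'d^'d \<Rightarrow> complex) set) \<and>
    ((\<exists>U\<in>X. \<exists>M\<in>X. trace_inner U M = 0) \<longrightarrow>
       card X \<le> cfun.dim (Hom s (s - 1) :: (complex^'d^'d \<Rightarrow> complex) set))"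
proof -
  define D where "D = {(cmod (trace_inner U M))\<^sup>2 |U M. U \<in> X \<and> M \<in> X \<and> U \<noteq> M}"
  have X: "finite X" "X \<subseteq> unitary_group" and D: "card D = s"
    using assms(2) by (auto simp: unitary_distance_set_def D_def)
  \<comment> \<open>An infinite set has \<open>card\<close> 0, so the positive cardinality s forces
    finiteness.\<close>
  have "finite D"
    using D assms(1) by (simp add: card_ge_0_finite)
  have DI: "(cmod (trace_inner U M))\<^sup>2 \<in> D" if "U \<in> X" "M \<in> X" "U \<noteq> M" for U M
    using that by (auto simp: D_def)
  have self: "trace_inner U U = of_nat CARD('d)" if "U \<in> X" for U
    using that X by (intro trace_inner_self) auto
  \<comment> \<open>This is where distinctness modulo phase enters. The factors of
    \<open>F E U U\<close> are d^2 - \<alpha>, so excluding the value d^2 keeps the diagonal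
    nonzero.\<close>
  have DN: "(real CARD('d))\<^sup>2 \<notin> D"
  proof
    assume "(real CARD('d))\<^sup>2 \<in> D"
    then obtain U M where UM: "U \<in> X" "M \<in> X" "U \<noteq> M"
      and "(real CARD('d))\<^sup>2 = (cmod (trace_inner U M))\<^sup>2"
      by (auto simp: D_def)
    then have "cmod (trace_inner U M) = CARD('d)" by simp
    then have "equal_up_to_phase M U"
      using UM X by (intro equal_up_to_phase_if_cmod_trace_inner) auto
    then show False using UM distinct_mod_phase by blast
  qed
  \<comment> \<open>The set of roots \<open>E\<close> is a parameter: the first bound takes all of
    \<open>D\<close>, the second takes \<open>D\<close> without 0.\<close>
  define F where "F E U = (\<lambda>M. \<Prod>\<alpha>\<in>E. complex_of_real ((cmod (trace_inner U M))\<^sup>2 - \<alpha>))"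
    for E and U :: "complex^'d^'d"
  have F_Hom: "on_unitary (F E U) \<in> Hom (card E) (card E)" if "E \<subseteq> D" for E U
  proof -
    have "finite E" using that \<open>finite D\<close> by (rule finite_subset)
    then show ?thesis
      unfolding F_def using Hom_prod[OF _ Hom_cmod_trace_inner_diff] by simp
  qed
  have F_diag: "F E U U \<noteq> 0" if "U \<in> X" "E \<subseteq> D" for E U
    using that DN \<open>finite D\<close> by (auto simp: F_def self finite_subset simp flip: of_real_diff)
  have F_off: "F E U M = 0" if "(cmod (trace_inner U M))\<^sup>2 \<in> E" "E \<subseteq> D" for E U M
    unfolding F_def using that \<open>finite D\<close>
    by (intro prod_zero bexI[of _ "(cmod (trace_inner U M))\<^sup>2"]) (auto intro: finite_subset)
  have "card X \<le> cfun.dim (Hom s s :: (complex^'d^'d \<Rightarrow> complex) set)"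
  proof -
    obtain G :: "(complex^'d^'d \<Rightarrow> complex) set" where G: "finite G" "Hom s s \<subseteq> cfun.span G"
      by (rule Hom_finitely_spanned)
    show ?thesis
    proof (rule card_le_dim_of_diagonal[OF X(1) G, where f = "\<lambda>U. on_unitary (F D U)"])
      show "on_unitary (F D U) \<in> Hom s s" for U
        using F_Hom[of D] D by simp
      show "on_unitary (F D U) U \<noteq> 0" if "U \<in> X" for U
        using that X F_diag[of U D] by (auto simp: on_unitary_def)
      show "on_unitary (F D U) M = 0" if "U \<in> X" "M \<in> X" "U \<noteq> M" for U M
        using F_off[OF DI[OF that]] by (simp add: on_unitary_def)
    qed
  qed
  moreover have "card X \<le> cfun.dim (Hom s (s - 1) :: (complex^'d^'d \<Rightarrow> complex) set)"
    if orth: "\<exists>U\<in>X. \<exists>M\<in>X. trace_inner U M = 0"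
  proof -
    define E where "E = D - {0}"
    define g where "g U = on_unitary (\<lambda>M. trace_inner U M * F E U M)" for U
    obtain U M where "U \<in> X" "M \<in> X" "trace_inner U M = 0"
      using orth by blast
    \<comment> \<open>The orthogonal pair is distinct, since \<open>trace_inner U U\<close> is d and
      thus nonzero.\<close>
    then have "0 \<in> D"
      using DI[of U M] self[of U] by (cases "U = M") auto
    then have E: "E \<subseteq> D" "card E = s - 1"
      using D by (auto simp: E_def)
    obtain G :: "(complex^'d^'d \<Rightarrow> complex) set" where G: "finite G" "Hom s (s - 1) \<subseteq> cfun.span G"
      by (rule Hom_finitely_spanned)
    show ?thesis
    proof (rule card_le_dim_of_diagonal[OF X(1) G, where f = g])
      \<comment> \<open>The bidegrees (1, 0) and (s - 1, s - 1) add up to (s, s - 1), where 1 + (s -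
        1) = s uses s > 0.\<close>
      show "g U \<in> Hom s (s - 1)" for U
        using Hom_mult[OF Hom_trace_inner F_Hom[OF E(1)]] E(2) assms(1) by (simp add: g_def)
      show "g U U \<noteq> 0" if "U \<in> X" for U
        using that X F_diag[OF that E(1)] by (auto simp: g_def on_unitary_def self)
      show "g U M = 0" if "U \<in> X" "M \<in> X" "U \<noteq> M" for U M
      \<comment> \<open>Orthogonal pairs are killed by the linear factor; any other pair has its
        value in \<open>E\<close> and is killed by \<open>F E U\<close>.\<close>
      proof (cases "trace_inner U M = 0")
        case False
        then have "(cmod (trace_inner U M))\<^sup>2 \<in> E"
          using DI[OF that] by (simp add: E_def)
        then show ?thesis using F_off E(1) by (simp add: g_def on_unitary_def)
      qed (simp add: g_def on_unitary_def)
    qed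
  qed
  ultimately show ?thesis by blast
qed

end
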